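(* Consider any instance of the congestion game in which every resource uses the Smith's Rule policy, and let $x$ be any (mixed) Nash equilibrium of it. Then there exists a feasible solution of (SDP-SR) with objective value at least $\frac14\, C(x)$, where $C$ is the social cost under Smith's Rule. This implies that the price of anarchy and the coordination ratio are at most $4$, i.e. $C(x)\le 4\,C(x^* )$ for every Nash equilibrium $x$ and every pure assignment $x^*$.
   Context: Congestion model. $N$ is a finite set of players and $E$ a finite set of resources. Each player $j\in N$ has a weight $w_j>0$, a nonempty strategy set $\mathcal S_j\subseteq 2^E$, and processing times $p_{ej}\in[0,\infty]$ $(e\in E)$, with $p_{ej}<\infty$ whenever $e$ belongs to some strategy $i\in\mathcal S_j$. The Smith ratio is $\delta_{ej}=p_{ej}/w_j$. For each $e\in E$, $\prec_e$ is a strict total order on $N$ such that $k\prec_e j$ implies $\delta_{ek}\le\delta_{ej}$ (ties broken consistently). An assignment is $x=(x_{ij})_{j\in N,i\in\mathcal S_j}$ with $x_{ij}\ge 0$ and $\sum_{i\in\mathcal S_j}x_{ij}=1$ for all $j$ ($x_{ij}$ is the probability that $j$ independently chooses $i$); it is pure if all $x_{ij}\in\{0,1\}$. Put $z_{ej}=\sum_{i\in\mathcal S_j:\,e\in i}x_{ij}$. Terms containing a factor $z_{ek}=0$ are read as $0$. Smith's Rule. The cost of player $j$ is $$C_j(x)=\sum_{i\in\mathcal S_j}x_{ij}\sum_{e\in i}\Big(p_{ej}+\sum_{k\prec_e j}p_{ek}z_{ek}\Big),$$ and the social cost is $C(x)=\sum_{j\in N}w_jC_j(x)$. Nash equilibrium.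 $x$ is a (mixed) Nash equilibrium if $C_j(x)\le C_j(x_{-j},i)$ for all $j\in N$, $i\in\mathcal S_j$, where $(x_{-j},i)$ is obtained from $x$ by letting $j$ choose $i$ with probability $1$. The price of anarchy is the worst ratio between the social cost of a Nash equilibrium and the minimum social cost of a pure assignment (under the same policy); the coordination ratio compares instead with the minimum over pure assignments of the social cost under Smith's Rule (here the two coincide). (SDP-SR): the variables are reals $y_j$ $(j\in N)$ and vectors $v_0, v_{ij}\in\mathbb R^d$ $(j\in N,i\in\mathcal S_j)$ for some $d\in\mathbb N$, with the standard inner product. Maximize $\sum_{j\in N}y_j-\frac12\|v_0\|^2$ subject to $y_j\le\sum_{e\in i}w_jp_{ej}-\frac12\|v_{ij}\|^2+\langle v_0,v_{ij}\rangle$ for all $j\in N,i\in\mathcal S_j$; and $\langle v_{ij},v_{i'k}\rangle\le\sum_{e\in i\cap i'}w_jw_k\min\{\delta_{ej},\delta_{ek}\}$ for all $(i,j)\ne(i',k)$ with $j,k\in N$, $i\in\mathcal S_j$, $i'\in\mathcal S_k$. *)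

theory Defs
  imports "HOL-Library.Extended_Real" "Jordan_Normal_Form.Matrix"
begin

(* prio G e contains (k, j) iff player k strictly precedes player j on resource e. *)
record ('p, 'e) congestion_game =
  players :: "'p set"
  resources :: "'e set"
  weight :: "'p \<Rightarrow> real"
  strategies :: "'p \<Rightarrow> 'e set set"
  ptime :: "'e \<Rightarrow> 'p \<Rightarrow> ereal"
  prio :: "'e \<Rightarrow> 'p rel"

definition smith_ratio :: "('p, 'e) congestion_game \<Rightarrow> 'e \<Rightarrow> 'p \<Rightarrow> ereal" where
  "smith_ratio G e j = ptime G e j / ereal (weight G j)"

definition congestion_instance :: "('p, 'e) congestion_game \<Rightarrow> bool" where
  "congestion_instance G \<longleftrightarrow>
     finite (players G) \<and> finite (resources G) \<and>
     (\<forall>j\<in>players G.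
        0 < weight G j \<and> strategies G j \<noteq> {} \<and> strategies G j \<subseteq> Pow (resources G) \<and>
        (\<forall>e\<in>resources G. 0 \<le> ptime G e j) \<and>
        (\<forall>i\<in>strategies G j. \<forall>e\<in>i. ptime G e j < \<infinity>)) \<and>
     (\<forall>e\<in>resources G.
        prio G e \<subseteq> players G \<times> players G \<and>
        strict_linear_order_on (players G) (prio G e) \<and>
        (\<forall>(k, j)\<in>prio G e. smith_ratio G e k \<le> smith_ratio G e j))"

(* An assignment x gives player j strategy i with probability x j i;
   values outside the players and their strategy sets are irrelevant. *)
type_synonym ('p, 'e) assignment = "'p \<Rightarrow> 'e set \<Rightarrow> real"

definition is_assignment :: "('p, 'e) congestion_game \<Rightarrow> ('p, 'e) assignment \<Rightarrow> bool" where
  "is_assignment G x \<longleftrightarrow>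
     (\<forall>j\<in>players G. (\<forall>i\<in>strategies G j. 0 \<le> x j i) \<and> (\<Sum>i\<in>strategies G j. x j i) = 1)"

definition is_pure_assignment :: "('p, 'e) congestion_game \<Rightarrow> ('p, 'e) assignment \<Rightarrow> bool" where
  "is_pure_assignment G x \<longleftrightarrow>
     is_assignment G x \<and> (\<forall>j\<in>players G. \<forall>i\<in>strategies G j. x j i \<in> {0, 1})"

definition use_prob :: "('p, 'e) congestion_game \<Rightarrow> ('p, 'e) assignment \<Rightarrow> 'e \<Rightarrow> 'p \<Rightarrow> real" where
  "use_prob G x e j = (\<Sum>i\<in>{i \<in> strategies G j. e \<in> i}. x j i)"

(* Extended-real multiplication satisfies \<infinity> * 0 = 0, so infinite processing times of players
   not using e contribute nothing. *)
definition smith_cost :: "('p, 'e) congestion_game \<Rightarrow> ('p, 'e) assignment \<Rightarrow> 'p \<Rightarrow> ereal" where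
  "smith_cost G x j =
     (\<Sum>i\<in>strategies G j. ereal (x j i) *
        (\<Sum>e\<in>i. ptime G e j +
           (\<Sum>k\<in>{k \<in> players G. (k, j) \<in> prio G e}. ptime G e k * ereal (use_prob G x e k))))"

(* The following notions are parametric in the policy, given by its players' cost function c. *)
definition social_cost ::
    "('p, 'e) congestion_game \<Rightarrow> (('p, 'e) assignment \<Rightarrow> 'p \<Rightarrow> ereal) \<Rightarrow> ('p, 'e) assignment \<Rightarrow> ereal" where
  "social_cost G c x = (\<Sum>j\<in>players G. ereal (weight G j) * c x j)"

definition deviate :: "('p, 'e) assignment \<Rightarrow> 'p \<Rightarrow> 'e set \<Rightarrow> ('p, 'e) assignment" where
  "deviate x j i = x(j := (\<lambda>i'. if i' = i then 1 else 0))"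

definition is_nash ::
    "('p, 'e) congestion_game \<Rightarrow> (('p, 'e) assignment \<Rightarrow> 'p \<Rightarrow> ereal) \<Rightarrow> ('p, 'e) assignment \<Rightarrow> bool" where
  "is_nash G c x \<longleftrightarrow>
     is_assignment G x \<and>
     (\<forall>j\<in>players G. \<forall>i\<in>strategies G j. c x j \<le> c (deviate x j i) j)"

(* Extended-real division: 0 / 0 = 0 and a / 0 = \<infinity> for a > 0. The infima range over the
   nonempty set of pure assignments, which take finitely many cost values, so they are minima. *)
definition price_of_anarchy ::
    "('p, 'e) congestion_game \<Rightarrow> (('p, 'e) assignment \<Rightarrow> 'p \<Rightarrow> ereal) \<Rightarrow> ereal" where
  "price_of_anarchy G c =
     (SUP x\<in>{x. is_nash G c x}.
        social_cost G c x / (INF y\<in>{y. is_pure_assignment G y}. social_cost G c y))"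

definition coordination_ratio ::
    "('p, 'e) congestion_game \<Rightarrow> (('p, 'e) assignment \<Rightarrow> 'p \<Rightarrow> ereal) \<Rightarrow> ereal" where
  "coordination_ratio G c =
     (SUP x\<in>{x. is_nash G c x}.
        social_cost G c x / (INF y\<in>{y. is_pure_assignment G y}. social_cost G (smith_cost G) y))"

(* R^d is carrier_vec d and the squared norm of u is scalar_prod u u; v j i is the vector of
   player j and strategy i. All processing times occurring in the constraints are finite. *)
definition sdp_sr_feasible ::
    "('p, 'e) congestion_game \<Rightarrow> nat \<Rightarrow> ('p \<Rightarrow> real) \<Rightarrow> real vec \<Rightarrow> ('p \<Rightarrow> 'e set \<Rightarrow> real vec) \<Rightarrow> bool" where
  "sdp_sr_feasible G d y v0 v \<longleftrightarrow>
     v0 \<in> carrier_vec d \<and>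
     (\<forall>j\<in>players G. \<forall>i\<in>strategies G j. v j i \<in> carrier_vec d) \<and>
     (\<forall>j\<in>players G. \<forall>i\<in>strategies G j.
        ereal (y j) \<le> (\<Sum>e\<in>i. ereal (weight G j) * ptime G e j)
          - ereal (1/2 * scalar_prod (v j i) (v j i)) + ereal (scalar_prod v0 (v j i))) \<and>
     (\<forall>j\<in>players G. \<forall>k\<in>players G. \<forall>i\<in>strategies G j. \<forall>i'\<in>strategies G k.
        (i, j) \<noteq> (i', k) \<longrightarrow>
        ereal (scalar_prod (v j i) (v k i')) \<le>
          (\<Sum>e\<in>i \<inter> i'. ereal (weight G j * weight G k) * min (smith_ratio G e j) (smith_ratio G e k)))"

definition sdp_sr_objective ::
    "('p, 'e) congestion_game \<Rightarrow> ('p \<Rightarrow> real) \<Rightarrow> real vec \<Rightarrow> real" where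
  "sdp_sr_objective G y v0 = (\<Sum>j\<in>players G. y j) - 1/2 * scalar_prod v0 v0"

end

theory Submission
  imports Defs
begin

text \<open>
  Let \<open>\<phi>\<^sub>i\<^sub>j(e, t)\<close> be \<open>w\<^sub>j\<close> if \<open>e \<in> i\<close> and \<open>0 \<le> t \<le> \<delta>\<^sub>e\<^sub>j\<close>, and \<open>0\<close> otherwise. The \<open>L\<^sup>2\<close> inner product of
  \<open>\<phi>\<^sub>i\<^sub>j\<close> and \<open>\<phi>\<^sub>i\<^sub>'\<^sub>k\<close> is exactly the right-hand side of the second constraint of (SDP-SR). With
  \<open>F = \<Sum> x\<^sub>i\<^sub>j \<phi>\<^sub>i\<^sub>j\<close>, splitting \<open>\<parallel>F\<parallel>\<^sup>2\<close> along the priority order gives \<open>\<parallel>F\<parallel>\<^sup>2 \<le> 2 C(x)\<close>, and the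
  Nash condition gives \<open>w\<^sub>j C\<^sub>j(x) \<le> \<parallel>\<phi>\<^sub>i\<^sub>j\<parallel>\<^sup>2 + \<langle>F, \<phi>\<^sub>i\<^sub>j\<rangle>\<close> for every strategy \<open>i\<close>. Hence
  \<open>v\<^sub>i\<^sub>j = \<phi>\<^sub>i\<^sub>j\<close>, \<open>v\<^sub>0 = F / 2\<close>, \<open>y\<^sub>j = w\<^sub>j C\<^sub>j(x) / 2\<close> is feasible with value
  \<open>C(x) / 2 - \<parallel>F\<parallel>\<^sup>2 / 8 \<ge> C(x) / 4\<close>.

  For a pure assignment \<open>x'\<close> with vector \<open>F'\<close> and \<open>D' = \<Sum> w\<^sub>j p\<^sub>e\<^sub>j z'\<^sub>e\<^sub>j\<close>, the splitting is the identity
  \<open>2 C(x') = \<parallel>F'\<parallel>\<^sup>2 + D'\<close>, and summing the Nash conditions gives \<open>C(x) \<le> D' + \<langle>F', F\<rangle> \<le>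
  D' + \<parallel>F'\<parallel>\<^sup>2 + \<parallel>F\<parallel>\<^sup>2 / 4 \<le> 2 C(x') + C(x) / 2\<close>.
\<close>

section \<open>Factoring the kernel \<open>min a a'\<close> over a finite set of nonnegative
  reals\<close>

text \<open>\<open>g l\<close> is the gap between \<open>l\<close> and its predecessor in
  \<open>A\<close>, with 0 preceding the least element, so the partial sums telescope. The induction
  adds a new maximum each time.\<close>

lemma nonneg_reals_partial_sums:
  fixes A :: "real set"
  assumes "finite A" "\<And>a. a \<in> A \<Longrightarrow> 0 \<le> a"
  obtains g where "\<And>l. l \<in> A \<Longrightarrow> 0 \<le> g l" "\<And>a. a \<in> A \<Longrightarrow> (\<Sum>l\<in>{l \<in> A. l \<le> a}. g l) = a"
proof -
  from assms have "\<exists>g. (\<forall>l\<in>A. 0 \<le> g l) \<and> (\<forall>a\<in>A. (\<Sum>l\<in>{l \<in> A. l \<le> a}. g l) = a)"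
  proof (induction A rule: finite_linorder_max_induct)
    case empty
    show ?case by simp
  next
    case (insert b A)
    then obtain g where g: "\<forall>l\<in>A. 0 \<le> g l" "\<forall>a\<in>A. (\<Sum>l\<in>{l \<in> A. l \<le> a}. g l) = a"
      by auto
    \<comment> \<open>The new gap is whatever is missing to reach \<open>b\<close>; as
      \<open>sum g A\<close> is \<open>Max A\<close> for nonempty \<open>A\<close>, it is
      nonnegative.\<close>
    define g' where "g' = g(b := b - sum g A)"
    have "b \<notin> A" using insert.hyps by auto
    have "sum g A \<le> b"
    proof (cases "A = {}")
      case True
      then show ?thesis using insert.prems by simp
    next
      case False
      with insert.hyps have M: "Max A \<in> A" by simp
      have "{l \<in> A. l \<le> Max A} = A" using insert.hyps by auto
      with g(2) M have "sum g A = Max A" by metis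
      then show ?thesis using insert.hyps M by (simp add: less_imp_le)
    qed
    then have "\<forall>l\<in>insert b A. 0 \<le> g' l" using g(1) by (simp add: g'_def)
    moreover have "(\<Sum>l\<in>{l \<in> insert b A. l \<le> a}. g' l) = a" if "a \<in> insert b A" for a
    proof (cases "a = b")
      case True
      then have "{l \<in> insert b A. l \<le> a} = insert b A" using insert.hyps by (auto simp: less_imp_le)
      moreover have "sum g' A = sum g A" using \<open>b \<notin> A\<close> by (intro sum.cong) (auto simp: g'_def)
      ultimately show ?thesis using insert.hyps \<open>b \<notin> A\<close> True by (simp add: g'_def)
    next
      case False
      with that have "a \<in> A" by simp
      then have "{l \<in> insert b A. l \<le> a} = {l \<in> A. l \<le> a}" using insert.hyps by fastforce
      moreover have "sum g' {l \<in> A. l \<le> a} = sum g {l \<in> A. l \<le> a}"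
        using \<open>b \<notin> A\<close> by (intro sum.cong) (auto simp: g'_def)
      ultimately show ?thesis using g(2) \<open>a \<in> A\<close> by simp
    qed
    ultimately show ?case by blast
  qed
  then show thesis using that by blast
qed

text \<open>A finite-dimensional substitute for the indicator functions of \<open>[0, a]\<close> in \<open>L\<^sup>2\<close>.\<close>

lemma min_kernel_Gram:
  fixes A :: "real set"
  assumes "finite A" "\<And>a. a \<in> A \<Longrightarrow> 0 \<le> a"
  obtains b where "\<And>a a'. a \<in> A \<Longrightarrow> a' \<in> A \<Longrightarrow> (\<Sum>l\<in>A. b a l * b a' l) = min a a'"
proof -
  obtain g where g: "\<And>l. l \<in> A \<Longrightarrow> 0 \<le> g l" "\<And>a. a \<in> A \<Longrightarrow> (\<Sum>l\<in>{l \<in> A. l \<le> a}. g l) = a"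
    using nonneg_reals_partial_sums[OF assms] by blast
  \<comment> \<open>The indicator of \<open>[0, a]\<close>, one coordinate per gap; the square root
    makes a product of two coordinates equal to the gap length.\<close>
  define b where "b a l = (if l \<le> a then sqrt (g l) else 0)" for a l
  have "(\<Sum>l\<in>A. b a l * b a' l) = min a a'" if "a \<in> A" "a' \<in> A" for a a'
  proof -
    have "(\<Sum>l\<in>A. b a l * b a' l) = (\<Sum>l\<in>A. if l \<le> min a a' then g l else 0)"
      by (intro sum.cong) (auto simp: b_def g(1))
    also have "\<dots> = (\<Sum>l\<in>{l \<in> A. l \<le> min a a'}. g l)"
      using assms(1) by (simp add: sum.If_cases Int_def)
    also have "\<dots> = min a a'" using that by (intro g(2)) (auto simp: min_def)
    finally show ?thesis .
  qed
  then show thesis using that by blast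
qed

text \<open>Two distinct elements are related in exactly one direction, and by symmetry both
  orientations of a pair contribute the same. Applied on each resource to its priority
  order.\<close>

lemma sum_symmetric_strict_linear_order:
  fixes f :: "'a \<Rightarrow> 'a \<Rightarrow> real"
  assumes "finite N" "strict_linear_order_on N r" "\<And>j k. f j k = f k j"
  shows "(\<Sum>j\<in>N. \<Sum>k\<in>N. f j k) = (\<Sum>j\<in>N. f j j) + 2 * (\<Sum>j\<in>N. \<Sum>k\<in>{k \<in> N. (k, j) \<in> r}. f j k)"
proof -
  have r: "trans r" "irrefl r" "total_on N r"
    using assms(2) by (auto simp: strict_linear_order_on_def)
  have "(\<Sum>k\<in>N. f j k) = f j j + (\<Sum>k\<in>{k \<in> N. (k, j) \<in> r}. f j k) + (\<Sum>k\<in>{k \<in> N. (j, k) \<in> r}. f j k)"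
    if "j \<in> N" for j
  proof -
    have "N = insert j ({k \<in> N. (k, j) \<in> r} \<union> {k \<in> N. (j, k) \<in> r})"
      using r(3) that by (auto simp: total_on_def)
    then have "(\<Sum>k\<in>N. f j k) = sum (f j) (insert j ({k \<in> N. (k, j) \<in> r} \<union> {k \<in> N. (j, k) \<in> r}))"
      by simp
    also have "\<dots> = f j j + sum (f j) ({k \<in> N. (k, j) \<in> r} \<union> {k \<in> N. (j, k) \<in> r})"
      using assms(1) r(2) by (subst sum.insert) (auto simp: irrefl_def)
    also have "sum (f j) ({k \<in> N. (k, j) \<in> r} \<union> {k \<in> N. (j, k) \<in> r}) =
        sum (f j) {k \<in> N. (k, j) \<in> r} + sum (f j) {k \<in> N. (j, k) \<in> r}"
      using assms(1) r(1,2) by (intro sum.union_disjoint) (auto simp: irrefl_def dest: transD)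
    finally show ?thesis by simp
  qed
  then have "(\<Sum>j\<in>N. \<Sum>k\<in>N. f j k) = (\<Sum>j\<in>N. f j j) + (\<Sum>j\<in>N. \<Sum>k\<in>{k \<in> N. (k, j) \<in> r}. f j k)
      + (\<Sum>j\<in>N. \<Sum>k\<in>{k \<in> N. (j, k) \<in> r}. f j k)"
    by (simp add: sum.distrib)
  also have "(\<Sum>j\<in>N. \<Sum>k\<in>{k \<in> N. (j, k) \<in> r}. f j k) = (\<Sum>k\<in>N. \<Sum>j\<in>{j \<in> N. (j, k) \<in> r}. f k j)"
    using assms(1,3) by (subst sum.swap_restrict) auto
  finally show ?thesis by simp
qed

text \<open>Covers the degenerate denominators: \<open>b = 0\<close> forces \<open>a = 0\<close>,
  and \<open>0 / 0 = 0\<close>; for \<open>b = \<infinity>\<close> the quotient of the finite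
  \<open>a\<close> is 0.\<close>

lemma ereal_divide_le_of_le_mult:
  fixes a b c :: ereal
  assumes "0 \<le> a" "0 \<le> b" "0 \<le> c" "a < \<infinity>" "a \<le> c * b"
  shows "a / b \<le> c"
proof (cases "b = 0 \<or> b = \<infinity>")
  case True
  then show ?thesis
  proof
    assume "b = 0"
    with assms have "a = 0" by simp
    then show ?thesis using assms by simp
  next
    assume "b = \<infinity>"
    then show ?thesis using assms by (cases a) auto
  qed
next
  case False
  with assms show ?thesis by (simp add: ereal_divide_le_pos mult.commute order_less_le)
qed

section \<open>Real-valued counterparts of processing times and costs\<close>

locale smith_instance =
  fixes G :: "('p, 'e) congestion_game"
  assumes inst: "congestion_instance G"
begin

text \<open>Infinite processing times become \<open>0\<close> here; they occur only with a factor \<open>use_prob G x e j = 0\<close>.\<close>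

definition p :: "'e \<Rightarrow> 'p \<Rightarrow> real" where "p e j = real_of_ereal (ptime G e j)"

definition ratio :: "'e \<Rightarrow> 'p \<Rightarrow> real" where "ratio e j = p e j / weight G j"

text \<open>On resource \<open>e\<close>, the function \<open>F\<close> of the overview is the sum
  over \<open>j\<close> of \<open>load x e j\<close> times the indicator of
  \<open>[0, ratio e j]\<close>.\<close>

definition load :: "('p, 'e) assignment \<Rightarrow> 'e \<Rightarrow> 'p \<Rightarrow> real" where
  "load x e j = weight G j * use_prob G x e j"

text \<open>The expected completion time of \<open>j\<close> on \<open>e\<close> given that
  \<open>j\<close> uses \<open>e\<close>.\<close>

definition completion :: "('p, 'e) assignment \<Rightarrow> 'e \<Rightarrow> 'p \<Rightarrow> real" where
  "completion x e j = p e j + (\<Sum>k\<in>{k \<in> players G. (k, j) \<in> prio G e}. p e k * use_prob G x e k)"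

definition cost :: "('p, 'e) assignment \<Rightarrow> 'p \<Rightarrow> real" where
  "cost x j = (\<Sum>i\<in>strategies G j. x j i * (\<Sum>e\<in>i. completion x e j))"

definition total_cost :: "('p, 'e) assignment \<Rightarrow> real" where
  "total_cost x = (\<Sum>j\<in>players G. weight G j * cost x j)"

text \<open>The inner product of the vectors \<open>F\<close> belonging to two assignments.\<close>

definition kernel :: "('p, 'e) assignment \<Rightarrow> ('p, 'e) assignment \<Rightarrow> real" where
  "kernel x y = (\<Sum>e\<in>resources G. \<Sum>j\<in>players G. \<Sum>k\<in>players G.
     load x e j * load y e k * min (ratio e j) (ratio e k))"

text \<open>The quantity \<open>D'\<close> of the overview, which is also the average of the squared
  norms of \<open>\<phi>\<^sub>i\<^sub>j\<close> with coefficients \<open>x j i\<close>.\<close>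

definition proc_cost :: "('p, 'e) assignment \<Rightarrow> real" where
  "proc_cost x = (\<Sum>e\<in>resources G. \<Sum>j\<in>players G. load x e j * p e j)"

lemma finite_players: "finite (players G)" and finite_resources: "finite (resources G)"
  using inst by (auto simp: congestion_instance_def)

lemma weight_pos: "j \<in> players G \<Longrightarrow> 0 < weight G j"
  using inst by (auto simp: congestion_instance_def)

lemma strategies_Pow: "j \<in> players G \<Longrightarrow> strategies G j \<subseteq> Pow (resources G)"
  using inst by (simp add: congestion_instance_def)

lemma strategy_subset: "j \<in> players G \<Longrightarrow> i \<in> strategies G j \<Longrightarrow> i \<subseteq> resources G"
  using strategies_Pow by blast

lemma finite_strategies: "j \<in> players G \<Longrightarrow> finite (strategies G j)"
  using finite_subset[OF strategies_Pow] finite_resources by simp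

lemma finite_strategy: "j \<in> players G \<Longrightarrow> i \<in> strategies G j \<Longrightarrow> finite i"
  using strategy_subset finite_resources finite_subset by metis

lemma ptime_nonneg: "e \<in> resources G \<Longrightarrow> j \<in> players G \<Longrightarrow> 0 \<le> ptime G e j"
  using inst by (auto simp: congestion_instance_def)

lemma p_nonneg: "e \<in> resources G \<Longrightarrow> j \<in> players G \<Longrightarrow> 0 \<le> p e j"
  by (simp add: p_def ptime_nonneg real_of_ereal_pos)

lemma ratio_nonneg: "e \<in> resources G \<Longrightarrow> j \<in> players G \<Longrightarrow> 0 \<le> ratio e j"
  by (simp add: ratio_def p_nonneg weight_pos less_imp_le)

lemma prio_order: "e \<in> resources G \<Longrightarrow> strict_linear_order_on (players G) (prio G e)"
  using inst by (auto simp: congestion_instance_def)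

lemma prio_irrefl: "e \<in> resources G \<Longrightarrow> (j, j) \<notin> prio G e"
  using prio_order by (auto simp: strict_linear_order_on_def irrefl_def)

lemma prio_ratio: "e \<in> resources G \<Longrightarrow> (k, j) \<in> prio G e \<Longrightarrow> smith_ratio G e k \<le> smith_ratio G e j"
  using inst by (auto simp: congestion_instance_def)

lemma ptime_real:
  assumes "j \<in> players G" "i \<in> strategies G j" "e \<in> i"
  shows "ptime G e j = ereal (p e j)"
proof -
  have "ptime G e j < \<infinity>" using inst assms by (auto simp: congestion_instance_def)
  moreover have "0 \<le> ptime G e j" using assms strategy_subset ptime_nonneg by blast
  ultimately show ?thesis by (cases "ptime G e j") (auto simp: p_def)
qed

lemma smith_ratio_real:
  assumes "j \<in> players G" "i \<in> strategies G j" "e \<in> i"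
  shows "smith_ratio G e j = ereal (ratio e j)"
  using ptime_real[OF assms] weight_pos[OF assms(1)] by (simp add: smith_ratio_def ratio_def)

text \<open>The Smith ratio of a predecessor \<open>k\<close> is at most that of \<open>j\<close>,
  which is finite because \<open>e\<close> lies in a strategy of \<open>j\<close>. Hence every
  processing time entering the cost of \<open>j\<close> is finite.\<close>

lemma prio_real:
  assumes "j \<in> players G" "i \<in> strategies G j" "e \<in> i" "k \<in> players G" "(k, j) \<in> prio G e"
  shows "ptime G e k = ereal (p e k)" "ratio e k \<le> ratio e j"
proof -
  have e: "e \<in> resources G" using assms strategy_subset by blast
  have *: "smith_ratio G e k \<le> ereal (ratio e j)"
    using prio_ratio[OF e assms(5)] smith_ratio_real[OF assms(1-3)] by simp
  show **: "ptime G e k = ereal (p e k)"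
    using * ptime_nonneg[OF e assms(4)] weight_pos[OF assms(4)]
    by (cases "ptime G e k") (auto simp: smith_ratio_def p_def)
  show "ratio e k \<le> ratio e j"
    using * ** weight_pos[OF assms(4)] by (simp add: smith_ratio_def ratio_def)
qed

lemma weight_ratio: "j \<in> players G \<Longrightarrow> weight G j * ratio e j = p e j"
  using weight_pos[of j] by (simp add: ratio_def)

lemma use_prob_nonzero:
  assumes "use_prob G x e j \<noteq> 0"
  obtains i where "i \<in> strategies G j" "e \<in> i"
  using assms unfolding use_prob_def by (metis (no_types, lifting) mem_Collect_eq sum.neutral)

lemma smith_cost_real:
  assumes j: "j \<in> players G"
  shows "smith_cost G x j = ereal (cost x j)"
proof -
  have "(\<Sum>e\<in>i. ptime G e j + (\<Sum>k\<in>{k \<in> players G. (k, j) \<in> prio G e}. ptime G e k * ereal (use_prob G x e k)))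
      = ereal (\<Sum>e\<in>i. completion x e j)" if i: "i \<in> strategies G j" for i
  proof -
    have "ptime G e j + (\<Sum>k\<in>{k \<in> players G. (k, j) \<in> prio G e}. ptime G e k * ereal (use_prob G x e k))
        = ereal (completion x e j)" if e: "e \<in> i" for e
    proof -
      have "(\<Sum>k\<in>{k \<in> players G. (k, j) \<in> prio G e}. ptime G e k * ereal (use_prob G x e k)) =
          (\<Sum>k\<in>{k \<in> players G. (k, j) \<in> prio G e}. ereal (p e k * use_prob G x e k))"
        using prio_real(1)[OF j i e] by (intro sum.cong) auto
      then show ?thesis by (simp add: completion_def ptime_real[OF j i e])
    qed
    then show ?thesis by simp
  qed
  then show ?thesis by (simp add: smith_cost_def cost_def)
qed

lemma social_cost_real: "social_cost G (smith_cost G) x = ereal (total_cost x)"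
  by (simp add: social_cost_def total_cost_def smith_cost_real)

text \<open>Double counting of the pairs \<open>(i, e)\<close> with
  \<open>e \<in> i\<close>.\<close>

lemma sum_strategies_resources:
  assumes j: "j \<in> players G"
  shows "(\<Sum>i\<in>strategies G j. x j i * (\<Sum>e\<in>i. h e)) = (\<Sum>e\<in>resources G. use_prob G x e j * h e)"
proof -
  have "(\<Sum>i\<in>strategies G j. x j i * (\<Sum>e\<in>i. h e)) =
      (\<Sum>i\<in>strategies G j. \<Sum>e\<in>{e \<in> resources G. e \<in> i}. x j i * h e)"
  proof (intro sum.cong refl)
    fix i assume "i \<in> strategies G j"
    then have "{e \<in> resources G. e \<in> i} = i" using strategy_subset[OF j] by auto
    then show "x j i * (\<Sum>e\<in>i. h e) = (\<Sum>e\<in>{e \<in> resources G. e \<in> i}. x j i * h e)"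
      by (simp add: sum_distrib_left)
  qed
  also have "\<dots> = (\<Sum>e\<in>resources G. \<Sum>i\<in>{i \<in> strategies G j. e \<in> i}. x j i * h e)"
    using finite_strategies[OF j] finite_resources by (rule sum.swap_restrict)
  finally show ?thesis by (simp add: use_prob_def sum_distrib_right)
qed

lemma use_prob_bounds:
  assumes "is_assignment G x" "j \<in> players G"
  shows "0 \<le> use_prob G x e j" "use_prob G x e j \<le> 1"
proof -
  have x: "\<And>i. i \<in> strategies G j \<Longrightarrow> 0 \<le> x j i" "(\<Sum>i\<in>strategies G j. x j i) = 1"
    using assms by (auto simp: is_assignment_def)
  show "0 \<le> use_prob G x e j" by (auto simp: use_prob_def intro!: sum_nonneg x(1))
  have "use_prob G x e j \<le> (\<Sum>i\<in>strategies G j. x j i)"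
    unfolding use_prob_def using x(1) finite_strategies[OF assms(2)] by (intro sum_mono2) auto
  then show "use_prob G x e j \<le> 1" using x(2) by simp
qed

lemma load_nonneg: "is_assignment G x \<Longrightarrow> j \<in> players G \<Longrightarrow> 0 \<le> load x e j"
  by (simp add: load_def use_prob_bounds weight_pos less_imp_le)

text \<open>A sum of zeros and ones is an integer, and this one lies between 0 and 1.\<close>

lemma pure_use_prob:
  assumes "is_pure_assignment G x" "j \<in> players G"
  shows "use_prob G x e j \<in> {0, 1}"
proof -
  have x: "is_assignment G x" and x01: "\<And>i. i \<in> strategies G j \<Longrightarrow> x j i \<in> {0, 1}"
    using assms by (auto simp: is_pure_assignment_def)
  have "use_prob G x e j \<in> \<int>"
    unfolding use_prob_def
  proof (intro Ints_sum)
    fix i assume "i \<in> {i \<in> strategies G j. e \<in> i}"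
    then show "x j i \<in> \<int>" using x01[of i] by auto
  qed
  then obtain n :: int where "use_prob G x e j = of_int n" by (auto elim: Ints_cases)
  then show ?thesis using use_prob_bounds[OF x assms(2), of e] by auto
qed

section \<open>Social cost in terms of the quadratic form \<open>kernel\<close>\<close>

lemma total_cost_resources:
  "total_cost x = (\<Sum>e\<in>resources G. \<Sum>j\<in>players G. load x e j * completion x e j)"
proof -
  have "total_cost x = (\<Sum>j\<in>players G. \<Sum>e\<in>resources G. load x e j * completion x e j)"
    unfolding total_cost_def
  proof (intro sum.cong refl)
    fix j assume "j \<in> players G"
    then show "weight G j * cost x j = (\<Sum>e\<in>resources G. load x e j * completion x e j)"
      by (simp add: cost_def sum_strategies_resources[of j x] sum_distrib_left[of "weight G j"] load_def mult.assoc)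
  qed
  then show ?thesis by (subst sum.swap)
qed

text \<open>Off the diagonal, the minimum is the ratio of the earlier player \<open>k\<close>, and
  its weight times this ratio is \<open>p e k\<close>: each ordered pair gives a waiting term of the
  cost, counted twice in \<open>kernel x x\<close>. The last sum is the diagonal.\<close>

lemma total_cost_kernel:
  "total_cost x = 1/2 * kernel x x + proc_cost x
     - 1/2 * (\<Sum>e\<in>resources G. \<Sum>j\<in>players G. use_prob G x e j * (load x e j * p e j))"
proof -
  have "2 * (\<Sum>j\<in>players G. load x e j * completion x e j) =
      (\<Sum>j\<in>players G. \<Sum>k\<in>players G. load x e j * load x e k * min (ratio e j) (ratio e k))
      + 2 * (\<Sum>j\<in>players G. load x e j * p e j)
      - (\<Sum>j\<in>players G. use_prob G x e j * (load x e j * p e j))"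
    if e: "e \<in> resources G" for e
  proof -
    let ?P = "\<lambda>j. {k \<in> players G. (k, j) \<in> prio G e}"
    have diag: "(\<Sum>j\<in>players G. load x e j * load x e j * min (ratio e j) (ratio e j)) =
        (\<Sum>j\<in>players G. use_prob G x e j * (load x e j * p e j))"
      by (intro sum.cong refl) (simp add: load_def weight_ratio[symmetric])
    have "(\<Sum>k\<in>?P j. load x e j * load x e k * min (ratio e j) (ratio e k)) =
        load x e j * (\<Sum>k\<in>?P j. p e k * use_prob G x e k)" if j: "j \<in> players G" for j
    \<comment> \<open>If \<open>j\<close> has infinite processing time on \<open>e\<close>, then
      \<open>ratio e j\<close> is the default 0 and the minimum need not be
      \<open>ratio e k\<close>. Such a \<open>j\<close> does not use \<open>e\<close>, so the factor
      \<open>load x e j\<close> vanishes.\<close>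
    proof (cases "use_prob G x e j = 0")
      case True
      then show ?thesis by (simp add: load_def)
    next
      case False
      then obtain i where i: "i \<in> strategies G j" "e \<in> i" by (rule use_prob_nonzero)
      show ?thesis unfolding sum_distrib_left
      proof (intro sum.cong refl)
        fix k assume "k \<in> ?P j"
        then have k: "k \<in> players G" "(k, j) \<in> prio G e" by auto
        have "min (ratio e j) (ratio e k) = ratio e k"
          using prio_real(2)[OF j i k] by simp
        then show "load x e j * load x e k * min (ratio e j) (ratio e k) = load x e j * (p e k * use_prob G x e k)"
          using weight_ratio[OF k(1), of e] by (simp add: load_def mult_ac)
      qed
    qed
    then have "(\<Sum>j\<in>players G. \<Sum>k\<in>?P j. load x e j * load x e k * min (ratio e j) (ratio e k)) =
        (\<Sum>j\<in>players G. load x e j * completion x e j) - (\<Sum>j\<in>players G. load x e j * p e j)"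
      by (simp add: completion_def distrib_left sum.distrib)
    then show ?thesis
      using sum_symmetric_strict_linear_order[OF finite_players prio_order[OF e],
          of "\<lambda>j k. load x e j * load x e k * min (ratio e j) (ratio e k)"] diag
      by (simp add: mult.commute min.commute)
  qed
  then have "2 * total_cost x = kernel x x + 2 * proc_cost x
     - (\<Sum>e\<in>resources G. \<Sum>j\<in>players G. use_prob G x e j * (load x e j * p e j))"
    by (simp add: total_cost_resources kernel_def proc_cost_def sum_distrib_left sum.distrib sum_subtractf)
  then show ?thesis by simp
qed

text \<open>Since usage probabilities are at most 1, the diagonal in
  \<open>total_cost_kernel\<close> is at most \<open>proc_cost x\<close>; at least half of
  \<open>proc_cost x\<close> remains and is dropped.\<close>

lemma kernel_le_total_cost:
  assumes "is_assignment G x"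
  shows "kernel x x \<le> 2 * total_cost x"
proof -
  have "(\<Sum>e\<in>resources G. \<Sum>j\<in>players G. use_prob G x e j * (load x e j * p e j)) \<le> proc_cost x"
    unfolding proc_cost_def
    using use_prob_bounds(2)[OF assms] load_nonneg[OF assms] p_nonneg
    by (intro sum_mono mult_left_le_one_le) (auto simp: use_prob_bounds(1)[OF assms])
  moreover have "0 \<le> proc_cost x"
    unfolding proc_cost_def using load_nonneg[OF assms] p_nonneg by (intro sum_nonneg) auto
  ultimately show ?thesis using total_cost_kernel[of x] by simp
qed

text \<open>Usage probabilities in \<open>{0, 1}\<close> equal their squares, so the diagonal is
  exactly \<open>proc_cost x\<close>.\<close>

lemma pure_total_cost:
  assumes "is_pure_assignment G x"
  shows "2 * total_cost x = kernel x x + proc_cost x"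
proof -
  have "(\<Sum>e\<in>resources G. \<Sum>j\<in>players G. use_prob G x e j * (load x e j * p e j)) = proc_cost x"
    unfolding proc_cost_def
  proof (intro sum.cong refl)
    fix e j assume "j \<in> players G"
    then show "use_prob G x e j * (load x e j * p e j) = load x e j * p e j"
      using pure_use_prob[OF assms, of j e] by (auto simp: load_def)
  qed
  then show ?thesis using total_cost_kernel[of x] by simp
qed

lemma total_cost_nonneg:
  assumes "is_assignment G x"
  shows "0 \<le> total_cost x"
  unfolding total_cost_resources completion_def
  using load_nonneg[OF assms] p_nonneg use_prob_bounds(1)[OF assms]
  by (intro sum_nonneg mult_nonneg_nonneg add_nonneg_nonneg) auto

section \<open>Consequences of the Nash condition\<close>

text \<open>The terms agree for the predecessors of \<open>j\<close>; extending the sum to all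
  players adds nonnegative terms and makes it the contribution of \<open>e\<close> to the inner
  product of \<open>F\<close> and \<open>\<phi>\<^sub>i\<^sub>j\<close>.\<close>

lemma weighted_completion_le:
  assumes "is_assignment G x" "j \<in> players G" "i \<in> strategies G j" "e \<in> i"
  shows "weight G j * completion x e j \<le>
    weight G j * p e j + (\<Sum>k\<in>players G. weight G j * load x e k * min (ratio e j) (ratio e k))"
proof -
  let ?P = "{k \<in> players G. (k, j) \<in> prio G e}"
  have e: "e \<in> resources G" using assms strategy_subset by blast
  have "weight G j * (\<Sum>k\<in>?P. p e k * use_prob G x e k) =
      (\<Sum>k\<in>?P. weight G j * load x e k * min (ratio e j) (ratio e k))"
    unfolding sum_distrib_left
  proof (intro sum.cong refl)
    fix k assume "k \<in> ?P"
    then have k: "k \<in> players G" "(k, j) \<in> prio G e" by auto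
    have "min (ratio e j) (ratio e k) = ratio e k"
      using prio_real(2)[OF assms(2-4) k] by simp
    then show "weight G j * (p e k * use_prob G x e k) = weight G j * load x e k * min (ratio e j) (ratio e k)"
      using weight_ratio[OF k(1), of e] by (simp add: load_def mult_ac)
  qed
  also have "\<dots> \<le> (\<Sum>k\<in>players G. weight G j * load x e k * min (ratio e j) (ratio e k))"
    using finite_players load_nonneg[OF assms(1)] ratio_nonneg[OF e] weight_pos[OF assms(2)] assms(2)
    by (intro sum_mono2) (auto intro!: mult_nonneg_nonneg)
  finally show ?thesis by (simp add: completion_def distrib_left)
qed

text \<open>The priority order is irreflexive, so the completion time of \<open>j\<close> does not
  depend on the choice of \<open>j\<close> itself.\<close>

lemma cost_deviate:
  assumes j: "j \<in> players G" and i: "i \<in> strategies G j"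
  shows "cost (deviate x j i) j = (\<Sum>e\<in>i. completion x e j)"
proof -
  have "completion (deviate x j i) e j = completion x e j" if "e \<in> i" for e
  proof -
    have "e \<in> resources G" using that strategy_subset[OF j i] by auto
    then have "use_prob G (deviate x j i) e k = use_prob G x e k" if "(k, j) \<in> prio G e" for k
      using prio_irrefl that by (auto simp: use_prob_def deviate_def)
    then show ?thesis by (simp add: completion_def)
  qed
  moreover have "cost (deviate x j i) j = (\<Sum>i'\<in>strategies G j. if i' = i then (\<Sum>e\<in>i'. completion (deviate x j i) e j) else 0)"
    unfolding cost_def by (intro sum.cong refl) (simp add: deviate_def)
  ultimately show ?thesis using i finite_strategies[OF j] by simp
qed

lemma nash_cost_le:
  assumes "is_nash G (smith_cost G) x" and j: "j \<in> players G" and i: "i \<in> strategies G j"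
  shows "weight G j * cost x j \<le> (\<Sum>e\<in>i. weight G j * p e j +
    (\<Sum>k\<in>players G. weight G j * load x e k * min (ratio e j) (ratio e k)))"
proof -
  have x: "is_assignment G x" using assms by (simp add: is_nash_def)
  have "cost x j \<le> (\<Sum>e\<in>i. completion x e j)"
    using assms by (simp add: is_nash_def smith_cost_real cost_deviate[symmetric])
  then have "weight G j * cost x j \<le> (\<Sum>e\<in>i. weight G j * completion x e j)"
    using weight_pos[OF j] by (simp add: sum_distrib_left[symmetric])
  also have "\<dots> \<le> (\<Sum>e\<in>i. weight G j * p e j +
    (\<Sum>k\<in>players G. weight G j * load x e k * min (ratio e j) (ratio e k)))"
    by (intro sum_mono weighted_completion_le[OF x j i])
  finally show ?thesis .
qed

text \<open>Averaging \<open>nash_cost_le\<close> over the strategies of each player with the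
  probabilities \<open>y j i\<close>.\<close>

lemma nash_total_cost_le:
  assumes "is_nash G (smith_cost G) x" "is_assignment G y"
  shows "total_cost x \<le> proc_cost y + kernel y x"
proof -
  let ?h = "\<lambda>j e. weight G j * p e j + (\<Sum>k\<in>players G. weight G j * load x e k * min (ratio e j) (ratio e k))"
  have "weight G j * cost x j \<le> (\<Sum>e\<in>resources G. use_prob G y e j * ?h j e)" if j: "j \<in> players G" for j
  proof -
    have y: "(\<Sum>i\<in>strategies G j. y j i) = 1" "\<And>i. i \<in> strategies G j \<Longrightarrow> 0 \<le> y j i"
      using assms(2) j by (auto simp: is_assignment_def)
    have "weight G j * cost x j = (\<Sum>i\<in>strategies G j. y j i * (weight G j * cost x j))"
      using y(1) by (simp add: sum_distrib_right[symmetric])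
    also have "\<dots> \<le> (\<Sum>i\<in>strategies G j. y j i * (\<Sum>e\<in>i. ?h j e))"
      using y(2) nash_cost_le[OF assms(1) j] by (intro sum_mono mult_left_mono) auto
    finally show ?thesis by (simp add: sum_strategies_resources[OF j])
  qed
  then have "total_cost x \<le> (\<Sum>j\<in>players G. \<Sum>e\<in>resources G. use_prob G y e j * ?h j e)"
    unfolding total_cost_def by (rule sum_mono)
  also have "\<dots> = (\<Sum>e\<in>resources G. \<Sum>j\<in>players G. use_prob G y e j * ?h j e)" by (rule sum.swap)
  also have "\<dots> = proc_cost y + kernel y x"
    unfolding proc_cost_def kernel_def sum.distrib[symmetric]
    by (intro sum.cong refl) (simp add: load_def distrib_left sum_distrib_left mult_ac)
  finally show ?thesis .
qed

section \<open>Finite-dimensional vectors for the kernel, and comparison with pure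
  assignments\<close>

text \<open>Collecting the ratios of all resources in one set \<open>A\<close> lets a single
  factorization serve every resource.\<close>

lemma ratio_Gram:
  obtains A :: "real set" and b where "finite A"
    "\<And>e j k. e \<in> resources G \<Longrightarrow> j \<in> players G \<Longrightarrow> k \<in> players G \<Longrightarrow>
      (\<Sum>l\<in>A. b (ratio e j) l * b (ratio e k) l) = min (ratio e j) (ratio e k)"
proof -
  define A where "A = (\<lambda>(e, j). ratio e j) ` (resources G \<times> players G)"
  have A: "finite A" "\<And>a. a \<in> A \<Longrightarrow> 0 \<le> a"
    using finite_players finite_resources by (auto simp: A_def ratio_nonneg)
  obtain b where "\<And>a a'. a \<in> A \<Longrightarrow> a' \<in> A \<Longrightarrow> (\<Sum>l\<in>A. b a l * b a' l) = min a a'"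
    using min_kernel_Gram[OF A] by blast
  then show thesis using A(1) by (intro that[of A b]) (auto simp: A_def)
qed

text \<open>The kernel becomes the standard inner product of vectors with coordinates indexed by
  pairs \<open>(e, l)\<close>, the discretized \<open>F\<close> of the two assignments.\<close>

lemma kernel_Gram:
  assumes "\<And>e j k. e \<in> resources G \<Longrightarrow> j \<in> players G \<Longrightarrow> k \<in> players G \<Longrightarrow>
      (\<Sum>l\<in>A. b (ratio e j) l * b (ratio e k) l) = min (ratio e j) (ratio e k)"
  shows "kernel x y = (\<Sum>e\<in>resources G. \<Sum>l\<in>A.
    (\<Sum>j\<in>players G. load x e j * b (ratio e j) l) * (\<Sum>k\<in>players G. load y e k * b (ratio e k) l))"
  unfolding kernel_def
proof (intro sum.cong refl)
  fix e assume e: "e \<in> resources G"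
  have "(\<Sum>j\<in>players G. \<Sum>k\<in>players G. load x e j * load y e k * min (ratio e j) (ratio e k)) =
      (\<Sum>j\<in>players G. \<Sum>k\<in>players G. \<Sum>l\<in>A.
        (load x e j * b (ratio e j) l) * (load y e k * b (ratio e k) l))"
    by (intro sum.cong refl) (simp add: assms[OF e, symmetric] sum_distrib_left mult_ac)
  also have "\<dots> = (\<Sum>j\<in>players G. \<Sum>l\<in>A. \<Sum>k\<in>players G.
        (load x e j * b (ratio e j) l) * (load y e k * b (ratio e k) l))"
    by (intro sum.cong refl sum.swap)
  also have "\<dots> = (\<Sum>l\<in>A. \<Sum>j\<in>players G. \<Sum>k\<in>players G.
        (load x e j * b (ratio e j) l) * (load y e k * b (ratio e k) l))"
    by (rule sum.swap)
  finally show "(\<Sum>j\<in>players G. \<Sum>k\<in>players G. load x e j * load y e k * min (ratio e j) (ratio e k)) =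
      (\<Sum>l\<in>A. (\<Sum>j\<in>players G. load x e j * b (ratio e j) l) * (\<Sum>k\<in>players G. load y e k * b (ratio e k) l))"
    by (simp add: sum_product)
qed

text \<open>Coordinatewise from \<open>(s - t/2)^2 \<ge> 0\<close>. The coefficient 1 matches
  \<open>pure_total_cost\<close>; with \<open>kernel_le_total_cost\<close>, the coefficient 1/4
  leaves half of \<open>total_cost x\<close>, which the left side of the Nash bound can
  absorb.\<close>

lemma kernel_AM_GM: "kernel y x \<le> kernel y y + 1/4 * kernel x x"
proof -
  obtain A :: "real set" and b where
    Ab: "\<And>e j k. e \<in> resources G \<Longrightarrow> j \<in> players G \<Longrightarrow> k \<in> players G \<Longrightarrow>
      (\<Sum>l\<in>A. b (ratio e j) l * b (ratio e k) l) = min (ratio e j) (ratio e k)"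
    using ratio_Gram by metis
  define F where "F z e l = (\<Sum>j\<in>players G. load z e j * b (ratio e j) l)" for z e l
  have kG: "kernel x y = (\<Sum>e\<in>resources G. \<Sum>l\<in>A. F x e l * F y e l)" for x y
    unfolding F_def by (rule kernel_Gram) (rule Ab)
  have am_gm: "s * t \<le> s * s + 1/4 * (t * t)" for s t :: real
    using zero_le_power2[of "s - t / 2"] by (simp add: power2_eq_square algebra_simps)
  show ?thesis
    unfolding kG sum_distrib_left sum.distrib[symmetric]
    by (intro sum_mono am_gm)
qed

lemma nash_le_pure:
  assumes "is_nash G (smith_cost G) x" "is_pure_assignment G y"
  shows "total_cost x \<le> 4 * total_cost y"
proof -
  have y: "is_assignment G y" and x: "is_assignment G x"
    using assms by (auto simp: is_pure_assignment_def is_nash_def)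
  have "total_cost x \<le> proc_cost y + kernel y x" by (rule nash_total_cost_le[OF assms(1) y])
  also have "\<dots> \<le> proc_cost y + kernel y y + 1/2 * total_cost x"
    using kernel_AM_GM[of y x] kernel_le_total_cost[OF x] by simp
  finally show ?thesis using pure_total_cost[OF assms(2)] by simp
qed

section \<open>The feasible solution of (SDP-SR)\<close>

lemma nash_sdp_solution:
  assumes "is_nash G (smith_cost G) x"
  shows "\<exists>d y v0 v. sdp_sr_feasible G d y v0 v \<and> 1/4 * total_cost x \<le> sdp_sr_objective G y v0"
proof -
  obtain A :: "real set" and b where A: "finite A" and
    Ab: "\<And>e j k. e \<in> resources G \<Longrightarrow> j \<in> players G \<Longrightarrow> k \<in> players G \<Longrightarrow>
      (\<Sum>l\<in>A. b (ratio e j) l * b (ratio e k) l) = min (ratio e j) (ratio e k)"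
    using ratio_Gram by metis
  have kG: "kernel x y = (\<Sum>e\<in>resources G. \<Sum>l\<in>A.
      (\<Sum>j\<in>players G. load x e j * b (ratio e j) l) * (\<Sum>k\<in>players G. load y e k * b (ratio e k) l))"
    for x y by (rule kernel_Gram) (rule Ab)
  \<comment> \<open>Numbers the coordinates \<open>(e, l)\<close>, as vectors are indexed by
    naturals.\<close>
  obtain h where h: "bij_betw h {0..<card (resources G \<times> A)} (resources G \<times> A)"
    using ex_bij_betw_nat_finite[of "resources G \<times> A"] A finite_resources by auto
  define d where "d = card (resources G \<times> A)"
  define V where "V f = vec d (\<lambda>n. case h n of (e, l) \<Rightarrow> f e l)" for f :: "'e \<Rightarrow> real \<Rightarrow> real"
  have V: "scalar_prod (V f) (V f') = (\<Sum>e\<in>resources G. \<Sum>l\<in>A. f e l * f' e l)" for f f'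
  proof -
    have "scalar_prod (V f) (V f') = (\<Sum>n\<in>{0..<d}. case h n of (e, l) \<Rightarrow> f e l * f' e l)"
      unfolding V_def scalar_prod_def by (auto intro!: sum.cong split: prod.split)
    also have "\<dots> = (\<Sum>(e, l)\<in>resources G \<times> A. f e l * f' e l)"
      using sum.reindex_bij_betw[OF h, of "\<lambda>(e, l). f e l * f' e l"] by (simp add: d_def)
    finally show ?thesis by (simp add: sum.cartesian_product)
  qed
  define v where "v j i = V (\<lambda>e l. if e \<in> i then weight G j * b (ratio e j) l else 0)" for j and i :: "'e set"
  \<comment> \<open>In the first constraint, half of the processing term is lost to the squared norm
    of \<open>v j i\<close>. Halving \<open>F\<close> and the cost as well turns the constraint into
    half of \<open>nash_cost_le\<close>.\<close>
  define v0 where "v0 = V (\<lambda>e l. 1/2 * (\<Sum>k\<in>players G. load x e k * b (ratio e k) l))"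
  define y where "y j = 1/2 * (weight G j * cost x j)" for j
  have restrict: "(\<Sum>e\<in>resources G. if e \<in> S then f e else 0) = sum f S" if "S \<subseteq> resources G"
    for S and f :: "'e \<Rightarrow> real"
    using that finite_resources by (simp add: sum.If_cases Int_absorb1)
  have vv: "scalar_prod (v j i) (v k i') = (\<Sum>e\<in>i \<inter> i'. weight G j * weight G k * min (ratio e j) (ratio e k))"
    if "j \<in> players G" "k \<in> players G" "i \<in> strategies G j" "i' \<in> strategies G k" for j k i i'
  proof -
    have "scalar_prod (v j i) (v k i') =
        (\<Sum>e\<in>resources G. if e \<in> i \<inter> i' then weight G j * weight G k * min (ratio e j) (ratio e k) else 0)"
      unfolding v_def V
      by (intro sum.cong refl) (auto simp: Ab[symmetric] that sum_distrib_left mult_ac)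
    then show ?thesis using strategy_subset[OF that(1,3)] by (subst (asm) restrict) auto
  qed
  have v0v: "scalar_prod v0 (v j i) =
      1/2 * (\<Sum>e\<in>i. \<Sum>k\<in>players G. weight G j * load x e k * min (ratio e j) (ratio e k))"
    if "j \<in> players G" "i \<in> strategies G j" for j i
  proof -
    have "scalar_prod v0 (v j i) = (\<Sum>e\<in>resources G. if e \<in> i then
        1/2 * (\<Sum>k\<in>players G. weight G j * load x e k * min (ratio e j) (ratio e k)) else 0)"
      unfolding v0_def v_def V
    proof (intro sum.cong refl)
      fix e assume e: "e \<in> resources G"
      have "(\<Sum>k\<in>players G. weight G j * load x e k * min (ratio e j) (ratio e k)) =
          (\<Sum>k\<in>players G. \<Sum>l\<in>A. load x e k * b (ratio e k) l * (weight G j * b (ratio e j) l))"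
        by (intro sum.cong refl) (simp add: Ab[symmetric] e that sum_distrib_left mult_ac)
      also have "\<dots> = (\<Sum>l\<in>A. (\<Sum>k\<in>players G. load x e k * b (ratio e k) l) * (weight G j * b (ratio e j) l))"
        by (subst sum.swap) (simp add: sum_distrib_right)
      finally show "(\<Sum>l\<in>A. 1/2 * (\<Sum>k\<in>players G. load x e k * b (ratio e k) l) *
            (if e \<in> i then weight G j * b (ratio e j) l else 0)) =
          (if e \<in> i then 1/2 * (\<Sum>k\<in>players G. weight G j * load x e k * min (ratio e j) (ratio e k)) else 0)"
        by (simp add: mult.assoc flip: sum_distrib_left sum_divide_distrib)
    qed
    then show ?thesis
      using strategy_subset[OF that] by (simp add: restrict sum_distrib_left)
  qed
  have v0v0: "scalar_prod v0 v0 = 1/4 * kernel x x"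
    unfolding v0_def V kG sum_distrib_left[of "1/4"]
    by (intro sum.cong refl) simp
  have "sdp_sr_feasible G d y v0 v"
    unfolding sdp_sr_feasible_def
  proof (intro conjI ballI impI)
    show "v0 \<in> carrier_vec d" by (simp add: v0_def V_def)
    show "v j i \<in> carrier_vec d" for j i by (simp add: v_def V_def)
  next
    fix j i assume ji: "j \<in> players G" "i \<in> strategies G j"
    have pt: "(\<Sum>e\<in>i. ereal (weight G j) * ptime G e j) = ereal (\<Sum>e\<in>i. weight G j * p e j)"
      using ptime_real[OF ji] by simp
    \<comment> \<open>On the diagonal the minimum is \<open>ratio e j\<close>, and one factor
      \<open>weight G j\<close> turns it into \<open>p e j\<close>.\<close>
    have "scalar_prod (v j i) (v j i) = (\<Sum>e\<in>i. weight G j * p e j)"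
      by (simp add: vv[OF ji(1,1,2,2)] weight_ratio[OF ji(1)] mult.assoc)
    then have "y j \<le> (\<Sum>e\<in>i. weight G j * p e j) - 1/2 * scalar_prod (v j i) (v j i) + scalar_prod v0 (v j i)"
      using nash_cost_le[OF assms ji] by (simp add: y_def v0v[OF ji] sum.distrib)
    then show "ereal (y j) \<le> (\<Sum>e\<in>i. ereal (weight G j) * ptime G e j)
          - ereal (1/2 * scalar_prod (v j i) (v j i)) + ereal (scalar_prod v0 (v j i))"
      unfolding pt by simp
  next
    fix j k i i' assume jk: "j \<in> players G" "k \<in> players G" "i \<in> strategies G j" "i' \<in> strategies G k"
    have "(\<Sum>e\<in>i \<inter> i'. ereal (weight G j * weight G k) * min (smith_ratio G e j) (smith_ratio G e k)) =
        (\<Sum>e\<in>i \<inter> i'. ereal (weight G j * weight G k * min (ratio e j) (ratio e k)))"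
      using smith_ratio_real[OF jk(1,3)] smith_ratio_real[OF jk(2,4)]
      by (intro sum.cong refl) (auto simp: min_def)
    then show "ereal (scalar_prod (v j i) (v k i')) \<le>
        (\<Sum>e\<in>i \<inter> i'. ereal (weight G j * weight G k) * min (smith_ratio G e j) (smith_ratio G e k))"
      by (simp add: vv[OF jk])
  qed
  moreover have "1/4 * total_cost x \<le> sdp_sr_objective G y v0"
  proof -
    have "is_assignment G x" using assms by (simp add: is_nash_def)
    moreover have "(\<Sum>j\<in>players G. y j) = 1/2 * total_cost x"
      by (simp add: y_def total_cost_def sum_distrib_left)
    ultimately show ?thesis
      using kernel_le_total_cost[of x] by (simp add: sdp_sr_objective_def v0v0)
  qed
  ultimately show ?thesis by blast
qed

section \<open>Price of anarchy and coordination ratio\<close>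

text \<open>For the policy \<open>smith_cost G\<close> both ratios are suprema of this same
  quotient.\<close>

lemma nash_ratio_le:
  assumes "is_nash G (smith_cost G) x"
  shows "social_cost G (smith_cost G) x /
    (INF y\<in>{y. is_pure_assignment G y}. social_cost G (smith_cost G) y) \<le> 4"
proof (rule ereal_divide_le_of_le_mult)
  let ?opt = "INF y\<in>{y. is_pure_assignment G y}. social_cost G (smith_cost G) y"
  show "0 \<le> social_cost G (smith_cost G) x" "social_cost G (smith_cost G) x < \<infinity>"
    using assms total_cost_nonneg by (auto simp: social_cost_real is_nash_def)
  show "0 \<le> ?opt"
    using total_cost_nonneg by (auto simp: social_cost_real is_pure_assignment_def intro!: INF_greatest)
  \<comment> \<open>Dividing by 4 first gives a common lower bound of all pure costs, hence of their
    infimum.\<close>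
  have "ereal (total_cost x / 4) \<le> ?opt"
  proof (rule INF_greatest)
    fix y assume "y \<in> {y. is_pure_assignment G y}"
    then show "ereal (total_cost x / 4) \<le> social_cost G (smith_cost G) y"
      using nash_le_pure[OF assms, of y] by (simp add: social_cost_real)
  qed
  then show "social_cost G (smith_cost G) x \<le> 4 * ?opt"
    unfolding social_cost_real[of x] by (cases ?opt) auto
qed simp

end

theorem theorem4p1:
  fixes G :: "('p, 'e) congestion_game"
  assumes "congestion_instance G"
  shows "(\<forall>x. is_nash G (smith_cost G) x \<longrightarrow>
            (\<exists>d y v0 v. sdp_sr_feasible G d y v0 v \<and>
               ereal (sdp_sr_objective G y v0) \<ge> 1/4 * social_cost G (smith_cost G) x)) \<and>
         (\<forall>x x'. is_nash G (smith_cost G) x \<longrightarrow> is_pure_assignment G x' \<longrightarrow>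
            social_cost G (smith_cost G) x \<le> 4 * social_cost G (smith_cost G) x') \<and>
         price_of_anarchy G (smith_cost G) \<le> 4 \<and>
         coordination_ratio G (smith_cost G) \<le> 4"
proof -
  interpret smith_instance G using assms by unfold_locales
  \<comment> \<open>The \<open>1/4\<close> on the left is a quotient of extended reals, the one on
    the right is real.\<close>
  have quarter: "1/4 * ereal c = ereal (1/4 * c)" for c
    by (simp add: one_ereal_def del: ereal_1_times)
  show ?thesis
  proof (intro conjI allI impI)
    fix x assume "is_nash G (smith_cost G) x"
    then show "\<exists>d y v0 v. sdp_sr_feasible G d y v0 v \<and>
        1/4 * social_cost G (smith_cost G) x \<le> ereal (sdp_sr_objective G y v0)"
      using nash_sdp_solution unfolding social_cost_real quarter ereal_less_eq by blast
  next
    fix x x' assume "is_nash G (smith_cost G) x" "is_pure_assignment G x'"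
    then show "social_cost G (smith_cost G) x \<le> 4 * social_cost G (smith_cost G) x'"
      using nash_le_pure by (simp add: social_cost_real)
  next
    show "price_of_anarchy G (smith_cost G) \<le> 4"
      unfolding price_of_anarchy_def using nash_ratio_le by (auto intro!: SUP_least)
    show "coordination_ratio G (smith_cost G) \<le> 4"
      unfolding coordination_ratio_def using nash_ratio_le by (auto intro!: SUP_least)
  qed
qed

end
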